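(* (1) Let $v:\mathbb{Z}^d\to[0,\infty)$ be a weight. The space $\ell^1_v(\mathbb{Z}^d)$ is a Banach algebra under convolution if and only if $v$ is submultiplicative on $\mathbb{Z}^d$, i.e. $v(k+l)\le v(k)v(l)$ for all $k,l\in\mathbb{Z}^d$. (2) Let $v:\mathbb{R}^d\to[0,\infty)$ be a continuous weight. The space $L^1_v(\mathbb{R}^d)$ is a Banach algebra under convolution if and only if $v$ is submultiplicative on $\mathbb{R}^d$, i.e. $v(x+y)\le v(x)v(y)$ for all $x,y\in\mathbb{R}^d$.
   Context: A weight is a non-negative function. $\ell^1_v(\mathbb{Z}^d)$ is the Banach space of complex sequences $\mathbf{a}=(a_k)_{k\in\mathbb{Z}^d}$ defined by the norm $\|\mathbf{a}\|_{\ell^1_v}=\sum_{k\in\mathbb{Z}^d}|a_k|v(k)<\infty$, and $L^1_v(\mathbb{R}^d)$ is the Banach space of (classes of almost everywhere equal) measurable functions defined by the norm $\|f\|_{L^1_v}=\int_{\mathbb{R}^d}|f(t)|v(t)\,dt<\infty$; it is understood that $v$ is such that these expressions are norms (in particular $v\not\equiv 0$). Convolution is $(\mathbf{a}*\mathbf{b})_l=\sum_{k} a_kb_{l-k}$, respectively $(f*g)(x)=\int_{\mathbb{R}^d} f(t)g(x-t)\,dt$. "Is a Banach algebra under convolution" means: for any two elements the defining sum converges absolutely for every $l$ (respectively the defining integral converges absolutely for almost every $x$), the convolution again belongs to the space, and the given norm is submultiplicative with constant $1$, i.e. $\|\mathbf{a}*\mathbf{b}\|_{\ell^1_v}\le\|\mathbf{a}\|_{\ell^1_v}\|\mathbf{b}\|_{\ell^1_v}$,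 respectively $\|f*g\|_{L^1_v}\le\|f\|_{L^1_v}\|g\|_{L^1_v}$. *)

theory Defs
  imports "HOL-Analysis.Analysis"
begin

text \<open>
  \<open>N\<close> is a norm on the space \<open>S\<close> of complex-valued functions. The predicate \<open>null\<close> singles out
  the functions representing the zero vector: the zero function for sequence spaces, the functions
  vanishing almost everywhere for spaces of classes of functions.
\<close>

definition norm_on ::
    "('a \<Rightarrow> complex) set \<Rightarrow> (('a \<Rightarrow> complex) \<Rightarrow> bool) \<Rightarrow> (('a \<Rightarrow> complex) \<Rightarrow> real) \<Rightarrow> bool" where
  "norm_on S null N \<longleftrightarrow>
     (\<forall>f\<in>S. 0 \<le> N f) \<and>
     (\<forall>f\<in>S. N f = 0 \<longleftrightarrow> null f) \<and>
     (\<forall>f\<in>S. \<forall>c. (\<lambda>x. c * f x) \<in> S \<and> N (\<lambda>x. c * f x) = cmod c * N f) \<and>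
     (\<forall>f\<in>S. \<forall>g\<in>S. (\<lambda>x. f x + g x) \<in> S \<and> N (\<lambda>x. f x + g x) \<le> N f + N g)"

definition seq_space :: "(int ^ 'd \<Rightarrow> real) \<Rightarrow> (int ^ 'd \<Rightarrow> complex) set" where
  "seq_space v = {a. (\<lambda>k. cmod (a k) * v k) summable_on UNIV}"

definition seq_norm :: "(int ^ 'd \<Rightarrow> real) \<Rightarrow> (int ^ 'd \<Rightarrow> complex) \<Rightarrow> real" where
  "seq_norm v a = (\<Sum>\<^sub>\<infinity>k. cmod (a k) * v k)"

definition seq_conv ::
    "(int ^ 'd \<Rightarrow> complex) \<Rightarrow> (int ^ 'd \<Rightarrow> complex) \<Rightarrow> int ^ 'd \<Rightarrow> complex" where
  "seq_conv a b l = (\<Sum>\<^sub>\<infinity>k. a k * b (l - k))"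

definition seq_norm_is_norm :: "(int ^ 'd \<Rightarrow> real) \<Rightarrow> bool" where
  "seq_norm_is_norm v \<longleftrightarrow> norm_on (seq_space v) (\<lambda>a. \<forall>k. a k = 0) (seq_norm v)"

definition seq_banach_algebra :: "(int ^ 'd \<Rightarrow> real) \<Rightarrow> bool" where
  "seq_banach_algebra v \<longleftrightarrow>
     (\<forall>a\<in>seq_space v. \<forall>b\<in>seq_space v.
        (\<forall>l. (\<lambda>k. cmod (a k * b (l - k))) summable_on UNIV) \<and>
        seq_conv a b \<in> seq_space v \<and>
        seq_norm v (seq_conv a b) \<le> seq_norm v a * seq_norm v b)"

text \<open>
  Elements of the weighted \<open>L\<^sup>1\<close> space are represented by Lebesgue measurable functions; two
  functions that agree almost everywhere represent the same element. All notions below depend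
  only on these classes.
\<close>

definition fun_space :: "(real ^ 'd \<Rightarrow> real) \<Rightarrow> (real ^ 'd \<Rightarrow> complex) set" where
  "fun_space v =
     {f. f \<in> borel_measurable lebesgue \<and> integrable lebesgue (\<lambda>t. cmod (f t) * v t)}"

definition fun_norm :: "(real ^ 'd \<Rightarrow> real) \<Rightarrow> (real ^ 'd \<Rightarrow> complex) \<Rightarrow> real" where
  "fun_norm v f = (LINT t|lebesgue. cmod (f t) * v t)"

text \<open>The Bochner integral is 0 at those \<open>x\<close> where the integrand is not integrable.\<close>

definition fun_conv ::
    "(real ^ 'd \<Rightarrow> complex) \<Rightarrow> (real ^ 'd \<Rightarrow> complex) \<Rightarrow> real ^ 'd \<Rightarrow> complex" where
  "fun_conv f g x = (LINT t|lebesgue. f t * g (x - t))"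

definition fun_norm_is_norm :: "(real ^ 'd \<Rightarrow> real) \<Rightarrow> bool" where
  "fun_norm_is_norm v \<longleftrightarrow>
     norm_on (fun_space v) (\<lambda>f. AE t in lebesgue. f t = 0) (fun_norm v)"

text \<open>Bochner integrability of the integrand is absolute convergence of the defining integral.\<close>

definition fun_banach_algebra :: "(real ^ 'd \<Rightarrow> real) \<Rightarrow> bool" where
  "fun_banach_algebra v \<longleftrightarrow>
     (\<forall>f\<in>fun_space v. \<forall>g\<in>fun_space v.
        (AE x in lebesgue. integrable lebesgue (\<lambda>t. f t * g (x - t))) \<and>
        fun_conv f g \<in> fun_space v \<and>
        fun_norm v (fun_conv f g) \<le> fun_norm v f * fun_norm v g)"

end

theory Submission
  imports Defs
begin

text \<open>
  If \<open>v\<close> is submultiplicative, then \<open>|a k b (l - k)| v l \<le> (|a k| v k) (|b (l - k)| v (l - k))\<close>,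
  and Tonelli's theorem gives everything; to divide by \<open>v\<close> one needs \<open>v > 0\<close>, which follows from
  the norm being definite. Conversely, on the lattice one tests with unit vectors, and on the
  Euclidean space with the indicator functions of small balls around \<open>x\<close> and \<open>y\<close>: their convolution
  has total mass the product of the two volumes and lives near \<open>x + y\<close>, so that
  continuity of \<open>v\<close> gives \<open>v (x + y) - e \<le> (v x + e) (v y + e)\<close>.
\<close>

section \<open>Tonelli for sums and nonnegative convolutions on a group\<close>

lemma has_sum_product_nonneg:
  fixes A :: "'a \<Rightarrow> real" and B :: "'b \<Rightarrow> real"
  assumes A: "A summable_on UNIV" and B: "B summable_on UNIV"
    and "\<And>k. 0 \<le> A k" "\<And>m. 0 \<le> B m"
  shows "((\<lambda>(k, m). A k * B m) has_sum infsum A UNIV * infsum B UNIV) UNIV"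
proof -
  have 1: "((\<lambda>m. A k * B m) has_sum A k * infsum B UNIV) UNIV" for k
    using B by (intro has_sum_cmult_right) (rule has_sum_infsum)
  have 2: "((\<lambda>k. A k * infsum B UNIV) has_sum infsum A UNIV * infsum B UNIV) UNIV"
    using A by (intro has_sum_cmult_left) (rule has_sum_infsum)
  \<comment> \<open>Because all terms are nonnegative, summable rows with summable row sums already
    give summability over all pairs.\<close>
  have "(\<lambda>(k, m). A k * B m) summable_on (UNIV \<times> UNIV)"
    by (rule summable_on_SigmaI[where g = "\<lambda>k. A k * infsum B UNIV"])
      (use 1 2 assms in \<open>auto simp: summable_on_def\<close>)
  then have "((\<lambda>(k, m). A k * B m) has_sum infsum A UNIV * infsum B UNIV) (UNIV \<times> UNIV)"
    by (intro has_sum_SigmaI[where g = "\<lambda>k. A k * infsum B UNIV"]) (use 1 2 in auto)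
  then show ?thesis by simp
qed

text \<open>The shear \<open>(l, k)\<close> to \<open>(k, l - k)\<close> is a bijection of pairs, so
  the convolution terms are a rearrangement of the product family. Each row of the rearranged family
  is one convolution sum, and adding the rows recovers the product of the totals.\<close>

lemma has_sum_convolution_nonneg:
  fixes A B :: "'a::ab_group_add \<Rightarrow> real"
  assumes "A summable_on UNIV" "B summable_on UNIV" "\<And>k. 0 \<le> A k" "\<And>m. 0 \<le> B m"
  shows "(\<lambda>k. A k * B (l - k)) summable_on UNIV"
    and "((\<lambda>l. \<Sum>\<^sub>\<infinity>k. A k * B (l - k)) has_sum infsum A UNIV * infsum B UNIV) UNIV"
proof -
  have bij: "bij_betw (\<lambda>(l, k). (k, l - k)) UNIV (UNIV :: ('a \<times> 'a) set)"
    by (rule bij_betwI[where g = "\<lambda>(k, m). (k + m, k)"]) auto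
  have *: "((\<lambda>(l, k). A k * B (l - k)) has_sum infsum A UNIV * infsum B UNIV) (UNIV \<times> UNIV)"
    using has_sum_product_nonneg[OF assms] has_sum_reindex_bij_betw[OF bij, of "\<lambda>(k, m). A k * B m"]
    by (simp add: case_prod_unfold)
  then have "(\<lambda>(l, k). A k * B (l - k)) summable_on (UNIV \<times> UNIV)"
    unfolding summable_on_def by blast
  then show s: "(\<lambda>k. A k * B (l - k)) summable_on UNIV" for l
    using summable_on_SigmaD1[of "\<lambda>l k. A k * B (l - k)" UNIV "\<lambda>_. UNIV" l] by simp
  show "((\<lambda>l. \<Sum>\<^sub>\<infinity>k. A k * B (l - k)) has_sum infsum A UNIV * infsum B UNIV) UNIV"
    by (rule has_sum_SigmaD[OF *]) (use s in \<open>auto intro: has_sum_infsum\<close>)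
qed

section \<open>The sequence space: unit vectors, positivity of the weight, both implications\<close>

lemma seq_norm_delta:
  fixes v :: "int ^ 'd::finite \<Rightarrow> real" and k :: "int ^ 'd"
  shows
  "seq_norm v (\<lambda>j. of_bool (j = k)) = v k" "(\<lambda>j. of_bool (j = k)) \<in> seq_space v"
proof -
  have "((\<lambda>j. cmod (of_bool (j = k)) * v j) has_sum v k) UNIV"
    using has_sum_finite_neutralI[of "{k}" UNIV "\<lambda>j. cmod (of_bool (j = k)) * v j" "v k"] by auto
  then show "seq_norm v (\<lambda>j. of_bool (j = k)) = v k" "(\<lambda>j. of_bool (j = k)) \<in> seq_space v"
    unfolding seq_norm_def seq_space_def summable_on_def by (auto intro: infsumI)
qed

lemma seq_conv_delta:
  fixes k l :: "int ^ 'd::finite"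
  shows
  "seq_conv (\<lambda>j. of_bool (j = k)) (\<lambda>j. of_bool (j = l)) = (\<lambda>j. of_bool (j = k + l))"
proof
  fix i
  have "seq_conv (\<lambda>j. of_bool (j = k)) (\<lambda>j. of_bool (j = l)) i
      = (\<Sum>\<^sub>\<infinity>j\<in>{k}. of_bool (j = k) * of_bool (i - j = l))"
    unfolding seq_conv_def by (rule infsum_cong_neutral) auto
  then show "seq_conv (\<lambda>j. of_bool (j = k)) (\<lambda>j. of_bool (j = l)) i = of_bool (i = k + l)"
    by (auto simp: algebra_simps)
qed

lemma seq_banach_algebra_imp_submult:
  fixes v :: "int ^ 'd::finite \<Rightarrow> real"
  assumes "seq_banach_algebra v"
  shows "v (k + l) \<le> v k * v l"
proof -
  let ?\<delta> = "\<lambda>k j. of_bool (j = k) :: complex"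
  have "seq_norm v (seq_conv (?\<delta> k) (?\<delta> l)) \<le> seq_norm v (?\<delta> k) * seq_norm v (?\<delta> l)"
    using assms seq_norm_delta(2)[where v = v] unfolding seq_banach_algebra_def by blast
  then show ?thesis unfolding seq_conv_delta seq_norm_delta(1) .
qed

text \<open>The unit vector at \<open>k\<close> is nonzero and has norm \<open>v k\<close>, so
  definiteness of the norm excludes \<open>v k = 0\<close>.\<close>

lemma seq_weight_pos:
  fixes v :: "int ^ 'd::finite \<Rightarrow> real"
  assumes "\<And>k. 0 \<le> v k" "seq_norm_is_norm v"
  shows "0 < v k"
proof -
  have "v k \<noteq> 0"
    using assms(2) seq_norm_delta[where v = v and k = k] unfolding seq_norm_is_norm_def norm_on_def by fastforce
  then show ?thesis using assms(1)[of k] by simp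
qed

lemma submult_imp_seq_banach_algebra:
  fixes v :: "int ^ 'd::finite \<Rightarrow> real"
  assumes pos: "\<And>k. 0 < v k" and sub: "\<And>k l. v (k + l) \<le> v k * v l"
  shows "seq_banach_algebra v"
  unfolding seq_banach_algebra_def
proof (intro ballI)
  fix a b assume a: "a \<in> seq_space v" and b: "b \<in> seq_space v"
  define A where "A = (\<lambda>k. cmod (a k) * v k)"
  define B where "B = (\<lambda>k. cmod (b k) * v k)"
  have v: "0 \<le> v k" for k using pos[of k] by simp
  define C where "C l = (\<Sum>\<^sub>\<infinity>k. A k * B (l - k))" for l
  have AB: "A summable_on UNIV" "B summable_on UNIV" "\<And>k. 0 \<le> A k" "\<And>k. 0 \<le> B k"
    using a b v by (auto simp: A_def B_def seq_space_def)
  have sum: "(\<lambda>k. A k * B (l - k)) summable_on UNIV" for l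
    by (rule has_sum_convolution_nonneg[OF AB])
  have C: "(C has_sum infsum A UNIV * infsum B UNIV) UNIV"
    unfolding C_def by (rule has_sum_convolution_nonneg[OF AB])
  have le: "cmod (a k * b (l - k)) * v l \<le> A k * B (l - k)" for k l
    using mult_left_mono[OF sub[of k "l - k"], of "cmod (a k * b (l - k))"]
    by (simp add: A_def B_def norm_mult mult_ac)
  \<comment> \<open>Dividing \<open>le\<close> by \<open>v l > 0\<close> gives a summable majorant
    at every \<open>l\<close>.\<close>
  have abs: "(\<lambda>k. cmod (a k * b (l - k))) summable_on UNIV" for l
  proof (rule summable_on_comparison_test[of "\<lambda>k. inverse (v l) * (A k * B (l - k))"])
    show "cmod (a k * b (l - k)) \<le> inverse (v l) * (A k * B (l - k))" for k
      using le[of k l] pos[of l] by (simp add: field_simps)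
  qed (auto intro: summable_on_cmult_right sum)
  \<comment> \<open>The total of \<open>C\<close> is the product of the two norms, so this one
    pointwise bound yields both membership in the space and the norm inequality.\<close>
  have le_C: "cmod (seq_conv a b l) * v l \<le> C l" for l
  proof -
    have "cmod (seq_conv a b l) * v l \<le> (\<Sum>\<^sub>\<infinity>k. cmod (a k * b (l - k))) * v l"
      unfolding seq_conv_def by (intro mult_right_mono norm_infsum_bound abs v)
    also have "\<dots> = (\<Sum>\<^sub>\<infinity>k. cmod (a k * b (l - k)) * v l)"
      using abs by (simp add: infsum_cmult_left)
    also have "\<dots> \<le> C l"
      unfolding C_def using abs sum le by (intro infsum_mono summable_on_cmult_left) auto
    finally show ?thesis .
  qed
  have s: "(\<lambda>l. cmod (seq_conv a b l) * v l) summable_on UNIV"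
    by (rule summable_on_comparison_test[OF has_sum_imp_summable[OF C] le_C]) (simp add: v)
  have "seq_norm v (seq_conv a b) \<le> infsum C UNIV"
    unfolding seq_norm_def by (rule infsum_mono[OF s has_sum_imp_summable[OF C] le_C])
  also have "\<dots> = seq_norm v a * seq_norm v b"
    by (simp add: infsumI[OF C] seq_norm_def A_def B_def)
  finally show "(\<forall>l. (\<lambda>k. cmod (a k * b (l - k))) summable_on UNIV) \<and>
      seq_conv a b \<in> seq_space v \<and> seq_norm v (seq_conv a b) \<le> seq_norm v a * seq_norm v b"
    using abs s by (auto simp: seq_space_def)
qed

section \<open>Reflections, Borel representatives and Tonelli for Lebesgue measure\<close>

lemma lborel_distr_diff:
  fixes a :: "'a::euclidean_space"
  shows "distr lborel borel (\<lambda>t. a - t) = lborel"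
  \<comment> \<open>The scaling factor -1 contributes the density |-1|^d = 1.\<close>
  by (subst (2) lborel_affine[of "-1" a]) (auto simp: density_1)

text \<open>Reflections preserve the measure and hence pull null sets back to null sets. The
  exceptional set itself need not be Borel, so the argument runs through a Borel null set
  \<open>N\<close> containing it.\<close>

lemma AE_lborel_diff:
  fixes a :: "'a::euclidean_space"
  assumes "AE t in lborel. P t"
  shows "AE t in lborel. P (a - t)"
proof -
  obtain N where N: "{t. \<not> P t} \<subseteq> N" "N \<in> null_sets lborel"
    using assms unfolding eventually_ae_filter by auto
  have "AE t in distr lborel borel (\<lambda>t. a - t). t \<notin> N"
    unfolding lborel_distr_diff by (rule AE_not_in[OF N(2)])
  then have "AE t in lborel. a - t \<notin> N"
    using N(2) by (subst (asm) AE_distr_iff) auto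
  then show ?thesis by eventually_elim (use N in auto)
qed

text \<open>For \<open>g\<close> that is merely Lebesgue measurable, measurability of
  \<open>g (x - t)\<close> in \<open>t\<close> requires preimages of Lebesgue sets, not just of
  Borel sets, to be Lebesgue sets.\<close>

lemma measurable_lebesgue_diff:
  fixes a :: "'a::euclidean_space"
  shows "(\<lambda>t. a - t) \<in> lebesgue \<rightarrow>\<^sub>M lebesgue"
proof -
  \<comment> \<open>This is \<open>a - t\<close> written as a diagonal affine map with every
    coefficient equal to -1.\<close>
  have "(\<lambda>t. a + (\<Sum>j\<in>Basis. (- 1 * (t \<bullet> j)) *\<^sub>R j)) \<in> lebesgue \<rightarrow>\<^sub>M lebesgue"
    by (rule lebesgue_affine_measurable) simp
  then show ?thesis
    by (simp add: sum_negf euclidean_representation)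
qed

lemma completion_ex_borel_measurable_complex:
  fixes f :: "'a \<Rightarrow> complex"
  assumes f: "f \<in> borel_measurable (completion M)"
  shows "\<exists>f'\<in>borel_measurable M. (AE x in M. f x = f' x)"
proof -
  obtain p q where pq: "p \<in> borel_measurable M" "AE x in M. Re (f x) = p x"
      "q \<in> borel_measurable M" "AE x in M. Im (f x) = q x"
    using completion_ex_borel_measurable_real[of "\<lambda>x. Re (f x)" M]
      completion_ex_borel_measurable_real[of "\<lambda>x. Im (f x)" M] f by auto
  show ?thesis
  proof (rule bexI[of _ "\<lambda>x. Complex (p x) (q x)"])
    show "(\<lambda>x. Complex (p x) (q x)) \<in> borel_measurable M"
      using pq unfolding Complex_eq by measurable
    show "AE x in M. f x = Complex (p x) (q x)"
      using pq(2,4) by eventually_elim (simp add: complex_eq_iff)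
  qed
qed

text \<open>After exchanging the integrals, translation invariance makes the inner integral over
  \<open>x\<close> independent of \<open>t\<close>.\<close>

lemma nn_integral_convolution:
  fixes F G :: "'a::euclidean_space \<Rightarrow> ennreal"
  assumes [measurable]: "F \<in> borel_measurable borel" "G \<in> borel_measurable borel"
  shows "(\<integral>\<^sup>+x. \<integral>\<^sup>+t. F t * G (x - t) \<partial>lborel \<partial>lborel)
    = (\<integral>\<^sup>+t. F t \<partial>lborel) * (\<integral>\<^sup>+t. G t \<partial>lborel)"
proof -
  have "(\<integral>\<^sup>+x. \<integral>\<^sup>+t. F t * G (x - t) \<partial>lborel \<partial>lborel)
      = (\<integral>\<^sup>+t. \<integral>\<^sup>+x. F t * G (x - t) \<partial>lborel \<partial>lborel)"
    by (rule lborel_pair.Fubini') measurable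
  also have "\<dots> = (\<integral>\<^sup>+t. F t * (\<integral>\<^sup>+x. G x \<partial>lborel) \<partial>lborel)"
  proof (rule nn_integral_cong)
    fix t :: 'a
    have "(\<integral>\<^sup>+x. G x \<partial>lborel) = (\<integral>\<^sup>+x. G x \<partial>distr lborel borel ((+) (- t)))"
      by (simp only: lborel_distr_plus)
    also have "\<dots> = (\<integral>\<^sup>+x. G (x - t) \<partial>lborel)"
      by (subst nn_integral_distr) auto
    finally show "(\<integral>\<^sup>+x. F t * G (x - t) \<partial>lborel) = F t * (\<integral>\<^sup>+x. G x \<partial>lborel)"
      by (simp add: nn_integral_cmult)
  qed
  finally show ?thesis by (simp add: nn_integral_multc)
qed

section \<open>The weighted L^1 space through nonnegative integrals over
  \<open>lborel\<close>\<close>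

lemma fun_space_iff_nn_integral:
  fixes v :: "real ^ 'd::finite \<Rightarrow> real"
  assumes [measurable]: "v \<in> borel_measurable borel" and "\<And>x. 0 \<le> v x"
  shows "f \<in> fun_space v \<longleftrightarrow> f \<in> borel_measurable lebesgue \<and>
    (\<integral>\<^sup>+t. ennreal (cmod (f t) * v t) \<partial>lborel) < \<infinity>"
proof (cases "f \<in> borel_measurable lebesgue")
  case True
  have [measurable]: "v \<in> borel_measurable lebesgue"
    by (intro measurable_completion) simp
  show ?thesis
    using True assms(2)
    by (simp add: fun_space_def integrable_iff_bounded nn_integral_completion abs_mult)
qed (simp add: fun_space_def)

lemma nn_integral_eq_fun_norm:
  assumes "f \<in> fun_space v" and "\<And>x. 0 \<le> v x"
  shows "(\<integral>\<^sup>+t. ennreal (cmod (f t) * v t) \<partial>lborel) = ennreal (fun_norm v f)"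
  using nn_integral_eq_integral[of lebesgue "\<lambda>t. cmod (f t) * v t"] assms
  by (simp add: fun_space_def fun_norm_def nn_integral_completion)

lemma fun_norm_nonneg: "(\<And>x. 0 \<le> v x) \<Longrightarrow> 0 \<le> fun_norm v f"
  unfolding fun_norm_def by (intro integral_nonneg_AE) auto

lemma bounded_indicator_in_fun_space:
  fixes v :: "real ^ 'd::finite \<Rightarrow> real"
  assumes [measurable]: "v \<in> borel_measurable borel" and v: "\<And>x. 0 \<le> v x"
    and [measurable]: "S \<in> sets borel" and S: "bounded S"
    and le: "\<And>t. t \<in> S \<Longrightarrow> v t \<le> c" and c: "0 \<le> c"
  shows "indicator S \<in> fun_space v" "fun_norm v (indicator S) \<le> c * measure lborel S"
proof -
  have fin: "emeasure lborel S < \<infinity>"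
    using S by (rule emeasure_bounded_finite)
  have "(\<integral>\<^sup>+t. ennreal (cmod (indicator S t) * v t) \<partial>lborel)
      \<le> (\<integral>\<^sup>+t. ennreal c * indicator S t \<partial>lborel)"
    by (rule nn_integral_mono) (use le in \<open>auto simp: indicator_def intro: ennreal_leI\<close>)
  also have "\<dots> = ennreal c * emeasure lborel S"
    by (rule nn_integral_cmult_indicator) simp
  also have "\<dots> = ennreal (c * measure lborel S)"
    using fin c by (simp add: emeasure_eq_ennreal_measure ennreal_mult)
  finally have *: "(\<integral>\<^sup>+t. ennreal (cmod (indicator S t) * v t) \<partial>lborel) \<le> ennreal (c * measure lborel S)" .
  have "(indicator S :: _ \<Rightarrow> complex) \<in> borel_measurable lebesgue"
    by (intro measurable_completion) simp
  with le_less_trans[OF * ennreal_less_top] show mem: "indicator S \<in> fun_space v"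
    using v by (simp add: fun_space_iff_nn_integral)
  show "fun_norm v (indicator S) \<le> c * measure lborel S"
    using * c unfolding nn_integral_eq_fun_norm[OF mem v] by (simp add: ennreal_le_iff)
qed

section \<open>Necessity on the Euclidean space: convolving indicators of balls\<close>

lemma cmod_fun_conv_indicator:
  fixes S T :: "(real ^ 'd::finite) set"
  assumes [measurable]: "S \<in> sets borel" "T \<in> sets borel" and S: "bounded S"
  shows "ennreal (cmod (fun_conv (indicator S) (indicator T) x))
    = (\<integral>\<^sup>+t. indicator S t * indicator T (x - t) \<partial>lborel)"
proof -
  define A where "A = S \<inter> (\<lambda>t. x - t) -` T"
  have "(\<lambda>t. x - t) -` T \<inter> space borel \<in> sets borel"
    by (rule measurable_sets[of _ borel borel]) auto
  then have A[measurable]: "A \<in> sets borel" by (simp add: A_def)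
  \<comment> \<open>Finiteness matters because \<open>measure\<close> is 0 on sets of infinite
    measure; here \<open>A\<close> lies in the bounded set \<open>S\<close>.\<close>
  have fin: "emeasure lborel A < \<infinity>"
    using S by (intro emeasure_bounded_finite) (auto simp: A_def intro: bounded_subset)
  have "fun_conv (indicator S) (indicator T) x
      = (LINT t|lebesgue. complex_of_real (indicator A t))"
    unfolding fun_conv_def by (intro Bochner_Integration.integral_cong) (auto simp: A_def indicator_def)
  also have "\<dots> = complex_of_real (measure lborel A)"
    by (subst integral_complex_of_real) (simp add: measure_completion)
  finally have "ennreal (cmod (fun_conv (indicator S) (indicator T) x)) = emeasure lborel A"
    using fin by (simp add: emeasure_eq_ennreal_measure)
  also have "\<dots> = (\<integral>\<^sup>+t. indicator A t \<partial>lborel)"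
    by simp
  also have "\<dots> = (\<integral>\<^sup>+t. indicator S t * indicator T (x - t) \<partial>lborel)"
    by (intro nn_integral_cong) (auto simp: A_def indicator_def)
  finally show ?thesis .
qed

lemma fun_banach_algebra_imp_submult:
  fixes v :: "real ^ 'd::finite \<Rightarrow> real"
  assumes v: "\<And>x. 0 \<le> v x" and cont: "continuous_on UNIV v" and alg: "fun_banach_algebra v"
  shows "v (x + y) \<le> v x * v y"
proof -
  have [measurable]: "v \<in> borel_measurable borel"
    using cont by (rule borel_measurable_continuous_onI)
  have approx: "v (x + y) - e \<le> (v x + e) * (v y + e)" if e: "0 < e" for e
  \<comment> \<open>In the remaining case \<open>c\<close> below is positive, so passing to
    \<open>ennreal c\<close> loses nothing; \<open>ennreal\<close> sends negative numbers to
    0.\<close>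
  proof (cases "v (x + y) - e \<le> 0")
    case True
    also have "0 \<le> (v x + e) * (v y + e)" using v[of x] v[of y] e by simp
    finally show ?thesis .
  next
    case False
    define c where "c = v (x + y) - e"
    have "\<exists>d>0. \<forall>t. dist t z < d \<longrightarrow> \<bar>v t - v z\<bar> < e" for z
      using cont e by (auto simp: continuous_on_iff dist_real_def)
    then obtain d where d: "\<And>z. d z > 0" "\<And>z t. dist t z < d z \<Longrightarrow> \<bar>v t - v z\<bar> < e"
      by metis
    \<comment> \<open>The factor 1/2 is there because a sum of a point of \<open>S\<close> and a
      point of \<open>T\<close> can be up to \<open>2 * r\<close> away from
      \<open>x + y\<close>.\<close>
    define r where "r = Min {d x, d y, d (x + y) / 2}"
    have r: "0 < r" "r \<le> d x" "r \<le> d y" "2 * r \<le> d (x + y)"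
      using d(1) by (auto simp: r_def)
    define S where "S = ball x r"
    define T where "T = ball y r"
    define h where "h = fun_conv (indicator S) (indicator T)"
    have [measurable]: "S \<in> sets borel" "T \<in> sets borel"
      by (auto simp: S_def T_def)
    have vS: "v t \<le> v x + e" if "t \<in> S" for t
      using that d(2)[of t x] r by (auto simp: S_def dist_commute)
    have vT: "v t \<le> v y + e" if "t \<in> T" for t
      using that d(2)[of t y] r by (auto simp: T_def dist_commute)
    have "indicator S \<in> fun_space v \<and> fun_norm v (indicator S) \<le> (v x + e) * measure lborel S"
      using bounded_indicator_in_fun_space[of v S "v x + e"] v[of x] e vS by (auto simp: v S_def)
    moreover have "indicator T \<in> fun_space v \<and> fun_norm v (indicator T) \<le> (v y + e) * measure lborel T"
      using bounded_indicator_in_fun_space[of v T "v y + e"] v[of y] e vT by (auto simp: v T_def)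
    ultimately have S: "indicator S \<in> fun_space v" "fun_norm v (indicator S) \<le> (v x + e) * measure lborel S"
      and T: "indicator T \<in> fun_space v" "fun_norm v (indicator T) \<le> (v y + e) * measure lborel T"
      by auto
    have h: "h \<in> fun_space v" "fun_norm v h \<le> fun_norm v (indicator S) * fun_norm v (indicator T)"
      using alg S T unfolding fun_banach_algebra_def h_def by auto
    have hS: "ennreal (cmod (h z)) = (\<integral>\<^sup>+t. indicator S t * indicator T (z - t) \<partial>lborel)" for z
      unfolding h_def by (rule cmod_fun_conv_indicator) (auto simp: S_def)
    have meas: "(\<integral>\<^sup>+z. ennreal (cmod (h z)) \<partial>lborel) = ennreal (measure lborel S * measure lborel T)"
    proof -
      have "emeasure lborel S < \<infinity>" "emeasure lborel T < \<infinity>"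
        unfolding S_def T_def by (rule emeasure_bounded_finite, simp)+
      then show ?thesis
        unfolding hS by (subst nn_integral_convolution)
          (auto simp: emeasure_eq_ennreal_measure ennreal_mult)
    qed
    \<comment> \<open>Where \<open>h z\<close> is nonzero, \<open>z\<close> splits as
      \<open>t + (z - t)\<close> with \<open>t\<close> in \<open>S\<close> and \<open>z - t\<close>
      in \<open>T\<close>. Hence \<open>z\<close> is close enough to \<open>x + y\<close> for
      \<open>v z\<close> to be at least \<open>c\<close>.\<close>
    have le: "ennreal c * ennreal (cmod (h z)) \<le> ennreal (cmod (h z) * v z)" for z
    proof (cases "h z = 0")
      case False
      have "\<exists>t. t \<in> S \<and> z - t \<in> T"
      proof (rule ccontr)
        assume "\<nexists>t. t \<in> S \<and> z - t \<in> T"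
        then have "(\<lambda>t. indicator S t * indicator T (z - t) :: ennreal) = (\<lambda>_. 0)"
          by (auto simp: indicator_def)
        then show False using hS[of z] False by simp
      qed
      then obtain t where t: "t \<in> S" "z - t \<in> T" by blast
      have "dist z (x + y) \<le> dist t x + dist (z - t) y"
        using norm_triangle_ineq[of "t - x" "z - t - y"] by (simp add: dist_norm algebra_simps)
      then have "dist z (x + y) < d (x + y)"
        using t r by (simp add: S_def T_def dist_commute)
      then have "c \<le> v z" using d(2)[of z "x + y"] by (simp add: c_def)
      then have "c * cmod (h z) \<le> cmod (h z) * v z"
        by (subst mult.commute) (rule mult_left_mono, simp_all)
      moreover have "0 \<le> c"
        using \<open>\<not> v (x + y) - e \<le> 0\<close> by (simp add: c_def)
      ultimately show ?thesis
        by (simp add: ennreal_mult[symmetric] ennreal_leI)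
    qed simp
    have meas_h: "(\<lambda>z. ennreal (cmod (h z))) \<in> borel_measurable lborel"
      unfolding hS by measurable
    have "ennreal (c * (measure lborel S * measure lborel T))
        = (\<integral>\<^sup>+z. ennreal c * ennreal (cmod (h z)) \<partial>lborel)"
      using False unfolding nn_integral_cmult[OF meas_h] by (simp add: meas c_def ennreal_mult)
    also have "\<dots> \<le> (\<integral>\<^sup>+z. ennreal (cmod (h z) * v z) \<partial>lborel)"
      by (rule nn_integral_mono) (rule le)
    also have "\<dots> = ennreal (fun_norm v h)"
      by (rule nn_integral_eq_fun_norm[OF h(1) v])
    finally have "c * (measure lborel S * measure lborel T) \<le> fun_norm v h"
      by (simp add: ennreal_le_iff fun_norm_nonneg v)
    also have "\<dots> \<le> ((v x + e) * measure lborel S) * ((v y + e) * measure lborel T)"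
      using v[of x] e by (intro order_trans[OF h(2)] mult_mono S T fun_norm_nonneg v) auto
    also have "\<dots> = ((v x + e) * (v y + e)) * (measure lborel S * measure lborel T)"
      by (simp add: mult_ac)
    finally have "c * (measure lborel S * measure lborel T)
      \<le> ((v x + e) * (v y + e)) * (measure lborel S * measure lborel T)" .
    \<comment> \<open>Both sides carry the same product of volumes; its positivity allows
      cancellation, leaving an inequality between values of \<open>v\<close> only.\<close>
    moreover have "0 < measure lborel S * measure lborel T"
      using r(1) content_ball_pos[of r x] content_ball_pos[of r y]
      by (simp add: S_def T_def measure_completion)
    ultimately show ?thesis unfolding c_def by (simp add: mult_le_cancel_right)
  qed
  \<comment> \<open>Letting \<open>e\<close> tend to 0 from the right removes the error
    terms.\<close>
  have lhs: "((\<lambda>e. v (x + y) - e) \<longlongrightarrow> v (x + y)) (at_right 0)"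
    by (auto intro!: tendsto_eq_intros)
  have rhs: "((\<lambda>e. (v x + e) * (v y + e)) \<longlongrightarrow> v x * v y) (at_right 0)"
    by (auto intro!: tendsto_eq_intros)
  have "eventually (\<lambda>e. v (x + y) - e \<le> (v x + e) * (v y + e)) (at_right 0)"
    using eventually_at_right_less by (rule eventually_mono) (rule approx)
  then show ?thesis
    by (rule tendsto_le[OF trivial_limit_at_right_real rhs lhs])
qed

section \<open>Sufficiency on the Euclidean space\<close>

text \<open>A single zero spreads: if \<open>v x = 0\<close>, then
  \<open>v t \<le> v x * v (t - x) = 0\<close> for all \<open>t\<close>. The constant function 1
  would then have norm 0 without vanishing almost everywhere, since the whole space is not a null
  set.\<close>

lemma submult_fun_weight_pos:
  fixes v :: "real ^ 'd::finite \<Rightarrow> real"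
  assumes v: "\<And>x. 0 \<le> v x" and norm: "fun_norm_is_norm v"
    and sub: "\<And>x y. v (x + y) \<le> v x * v y"
  shows "0 < v x"
proof (rule ccontr)
  assume "\<not> 0 < v x"
  then have "v x = 0" using v[of x] by simp
  then have [simp]: "v t = 0" for t
    using sub[of x "t - x"] v[of t] by simp
  have one: "(\<lambda>_. 1) \<in> fun_space v" "fun_norm v (\<lambda>_. 1) = 0"
    by (auto simp: fun_space_def fun_norm_def)
  have "\<forall>f\<in>fun_space v. fun_norm v f = 0 \<longleftrightarrow> (AE t in lebesgue. f t = 0)"
    using norm unfolding fun_norm_is_norm_def norm_on_def by blast
  from bspec[OF this one(1)] have "AE t in (lebesgue :: (real ^ 'd) measure). (1::complex) = 0"
    using one(2) by simp
  then show False
    by (simp add: AE_completion_iff AE_iff_measurable[OF _ refl] emeasure_lborel_UNIV)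
qed

lemma submult_imp_fun_banach_algebra:
  fixes v :: "real ^ 'd::finite \<Rightarrow> real"
  assumes pos: "\<And>x. 0 < v x" and [measurable]: "v \<in> borel_measurable borel"
    and sub: "\<And>x y. v (x + y) \<le> v x * v y"
  shows "fun_banach_algebra v"
  unfolding fun_banach_algebra_def
proof (intro ballI)
  fix f g assume f: "f \<in> fun_space v" and g: "g \<in> fun_space v"
  have v: "0 \<le> v x" for x using pos[of x] by simp
  have fg[measurable]: "f \<in> borel_measurable lebesgue" "g \<in> borel_measurable lebesgue"
    using f g by (auto simp: fun_space_def)
  \<comment> \<open>Fubini needs joint measurability of \<open>g (x - t)\<close>, which is available for Borel functions only.\<close>
  obtain f' where f'[measurable]: "f' \<in> borel_measurable borel" and eqf: "AE t in lborel. f t = f' t"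
    using completion_ex_borel_measurable_complex[OF fg(1)] by auto
  obtain g' where g'[measurable]: "g' \<in> borel_measurable borel" and eqg: "AE t in lborel. g t = g' t"
    using completion_ex_borel_measurable_complex[OF fg(2)] by auto
  define F where "F t = ennreal (cmod (f' t) * v t)" for t
  define G where "G t = ennreal (cmod (g' t) * v t)" for t
  have [measurable]: "F \<in> borel_measurable borel" "G \<in> borel_measurable borel"
    unfolding F_def G_def by measurable
  have F: "(\<integral>\<^sup>+t. F t \<partial>lborel) = ennreal (fun_norm v f)"
    unfolding nn_integral_eq_fun_norm[OF f v, symmetric] F_def
    using eqf by (intro nn_integral_cong_AE) (auto elim!: eventually_mono)
  have G: "(\<integral>\<^sup>+t. G t \<partial>lborel) = ennreal (fun_norm v g)"
    unfolding nn_integral_eq_fun_norm[OF g v, symmetric] G_def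
    using eqg by (intro nn_integral_cong_AE) (auto elim!: eventually_mono)
  \<comment> \<open>\<open>H\<close> is the convolution of the absolute values, taken in the
    extended nonnegative reals. It makes sense at every \<open>x\<close>, and its finiteness at
    \<open>x\<close> is absolute convergence there.\<close>
  define H where "H x = (\<integral>\<^sup>+t. ennreal (cmod (f' t * g' (x - t))) \<partial>lborel)" for x
  have [measurable]: "H \<in> borel_measurable borel"
    unfolding H_def by measurable
  have "H x * ennreal (v x) \<le> (\<integral>\<^sup>+t. F t * G (x - t) \<partial>lborel)" for x
  proof -
    have "H x * ennreal (v x) = (\<integral>\<^sup>+t. ennreal (cmod (f' t * g' (x - t))) * ennreal (v x) \<partial>lborel)"
      unfolding H_def by (subst nn_integral_multc) auto
    also have "\<dots> \<le> (\<integral>\<^sup>+t. F t * G (x - t) \<partial>lborel)"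
    proof (rule nn_integral_mono)
      fix t
      have "cmod (f' t * g' (x - t)) * v x \<le> (cmod (f' t) * v t) * (cmod (g' (x - t)) * v (x - t))"
        using mult_left_mono[OF sub[of t "x - t"], of "cmod (f' t * g' (x - t))"]
        by (simp add: norm_mult mult_ac)
      then show "ennreal (cmod (f' t * g' (x - t))) * ennreal (v x) \<le> F t * G (x - t)"
        unfolding F_def G_def using v by (simp add: ennreal_mult[symmetric] ennreal_leI)
    qed
    finally show ?thesis .
  qed
  then have "(\<integral>\<^sup>+x. H x * ennreal (v x) \<partial>lborel) \<le> (\<integral>\<^sup>+x. \<integral>\<^sup>+t. F t * G (x - t) \<partial>lborel \<partial>lborel)"
    by (intro nn_integral_mono)
  also have "\<dots> = ennreal (fun_norm v f * fun_norm v g)"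
    using v by (subst nn_integral_convolution) (auto simp: F G ennreal_mult fun_norm_nonneg)
  finally have HV: "(\<integral>\<^sup>+x. H x * ennreal (v x) \<partial>lborel) \<le> ennreal (fun_norm v f * fun_norm v g)" .
  \<comment> \<open>For each fixed \<open>x\<close> the two integrands agree for almost every
    \<open>t\<close>. Replacing \<open>f\<close> and \<open>g\<close> by their Borel representatives
    therefore changes neither integrability nor the convolution at any \<open>x\<close>.\<close>
  have cong: "AE t in lebesgue. f t * g (x - t) = f' t * g' (x - t)" for x
    using eqf AE_lborel_diff[OF eqg, of x] unfolding AE_completion_iff by eventually_elim simp
  have meas: "(\<lambda>t. f t * g (x - t)) \<in> borel_measurable lebesgue" for x
    using measurable_compose[OF measurable_lebesgue_diff fg(2)] by measurable
  have meas'_lborel: "(\<lambda>t. f' t * g' (x - t)) \<in> borel_measurable lborel" for x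
    by measurable
  then have meas': "(\<lambda>t. f' t * g' (x - t)) \<in> borel_measurable lebesgue" for x
    by (rule measurable_completion)
  have int_iff: "integrable lebesgue (\<lambda>t. f t * g (x - t)) \<longleftrightarrow> H x < \<infinity>" for x
  proof -
    have "integrable lebesgue (\<lambda>t. f t * g (x - t)) \<longleftrightarrow> integrable lebesgue (\<lambda>t. f' t * g' (x - t))"
      by (rule integrable_cong_AE[OF meas meas' cong])
    then show ?thesis
      using meas' by (simp add: integrable_iff_bounded nn_integral_completion H_def)
  qed
  have conv: "fun_conv f g x = (LINT t|lborel. f' t * g' (x - t))" for x
    unfolding fun_conv_def integral_cong_AE[OF meas meas' cong]
    by (rule integral_completion[OF meas'_lborel])
  \<comment> \<open>A finite integral makes the product finite almost everywhere. As infinity times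
    0 is 0 in \<open>ennreal\<close>, it is \<open>v x > 0\<close> that turns this into finiteness
    of \<open>H x\<close>.\<close>
  have "AE x in lborel. H x * ennreal (v x) \<noteq> \<infinity>"
  proof (rule nn_integral_PInf_AE)
    show "(\<integral>\<^sup>+x. H x * ennreal (v x) \<partial>lborel) \<noteq> \<infinity>"
      using HV by (auto simp: top_unique)
  qed measurable
  then have "AE x in lborel. H x < \<infinity>"
  proof eventually_elim
    fix x
    assume "H x * ennreal (v x) \<noteq> \<infinity>"
    moreover have "ennreal (v x) \<noteq> 0" using pos[of x] by (simp add: ennreal_eq_0_iff)
    ultimately show "H x < \<infinity>" by (auto simp: ennreal_mult_eq_top_iff less_top)
  qed
  then have int: "AE x in lebesgue. integrable lebesgue (\<lambda>t. f t * g (x - t))"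
    unfolding int_iff AE_completion_iff .
  \<comment> \<open>Measurability in \<open>x\<close> comes from the Borel representatives, for
    which the integrand is jointly measurable.\<close>
  have "fun_conv f g \<in> borel_measurable lborel"
    unfolding conv[abs_def] by measurable
  then have meas_conv: "fun_conv f g \<in> borel_measurable lebesgue"
    by (rule measurable_completion)
  \<comment> \<open>The bound holds at every \<open>x\<close>: where the integrand is not
    integrable, the Bochner integral takes the default value 0.\<close>
  have conv_le: "ennreal (cmod (fun_conv f g x)) \<le> H x" for x
  proof (cases "integrable lborel (\<lambda>t. f' t * g' (x - t))")
    case True
    then show ?thesis unfolding conv H_def by (rule integral_norm_bound_ennreal)
  qed (simp add: conv not_integrable_integral_eq)
  have "(\<integral>\<^sup>+x. ennreal (cmod (fun_conv f g x) * v x) \<partial>lborel) \<le> (\<integral>\<^sup>+x. H x * ennreal (v x) \<partial>lborel)"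
    using v by (intro nn_integral_mono) (simp add: ennreal_mult mult_right_mono conv_le)
  also note HV
  finally have le: "(\<integral>\<^sup>+x. ennreal (cmod (fun_conv f g x) * v x) \<partial>lborel)
      \<le> ennreal (fun_norm v f * fun_norm v g)" .
  then have mem: "fun_conv f g \<in> fun_space v"
    using meas_conv v le_less_trans[OF le ennreal_less_top] by (simp add: fun_space_iff_nn_integral)
  have "fun_norm v (fun_conv f g) \<le> fun_norm v f * fun_norm v g"
    using le v unfolding nn_integral_eq_fun_norm[OF mem v]
    by (simp add: ennreal_le_iff fun_norm_nonneg)
  with int mem show "(AE x in lebesgue. integrable lebesgue (\<lambda>t. f t * g (x - t))) \<and>
      fun_conv f g \<in> fun_space v \<and> fun_norm v (fun_conv f g) \<le> fun_norm v f * fun_norm v g"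
    by blast
qed

theorem lemma4p1:
  "(\<forall>v :: int ^ 'd::finite \<Rightarrow> real.
      (\<forall>k. 0 \<le> v k) \<longrightarrow> seq_norm_is_norm v \<longrightarrow>
      (seq_banach_algebra v \<longleftrightarrow> (\<forall>k l. v (k + l) \<le> v k * v l))) \<and>
   (\<forall>v :: real ^ 'd::finite \<Rightarrow> real.
      (\<forall>x. 0 \<le> v x) \<longrightarrow> continuous_on UNIV v \<longrightarrow> fun_norm_is_norm v \<longrightarrow>
      (fun_banach_algebra v \<longleftrightarrow> (\<forall>x y. v (x + y) \<le> v x * v y)))"
proof (intro conjI allI impI iffI)
  fix v :: "int ^ 'd \<Rightarrow> real"
  assume v: "\<forall>k. 0 \<le> v k" "seq_norm_is_norm v"
  show "v (k + l) \<le> v k * v l" if "seq_banach_algebra v" for k l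
    using that by (rule seq_banach_algebra_imp_submult)
  show "seq_banach_algebra v" if "\<forall>k l. v (k + l) \<le> v k * v l"
    using that v by (intro submult_imp_seq_banach_algebra seq_weight_pos) auto
next
  fix v :: "real ^ 'd \<Rightarrow> real"
  assume v: "\<forall>x. 0 \<le> v x" "continuous_on UNIV v" "fun_norm_is_norm v"
  show "v (x + y) \<le> v x * v y" if "fun_banach_algebra v" for x y
    using that v by (intro fun_banach_algebra_imp_submult) auto
  show "fun_banach_algebra v" if "\<forall>x y. v (x + y) \<le> v x * v y"
    using that v by (intro submult_imp_fun_banach_algebra submult_fun_weight_pos
        borel_measurable_continuous_onI) auto
qed

end
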